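(* Let $N\ge 2$, $h=1/N$, $x_j=jh$ for $0\le j\le N$, let $\mathfrak{u}\in l^2_{h,0}$ and let $s_{\mathfrak{u}}$ be the cubic spline interpolating $\mathfrak{u}$. Then the jump of the third derivative of $s_{\mathfrak{u}}$ at the interior nodes is given by $$s_{\mathfrak{u}}'''(x_j^+)-s_{\mathfrak{u}}'''(x_j^-)=h\,(\delta_x^4\mathfrak{u})_j,\qquad 1\le j\le N-1,$$ where $s_{\mathfrak{u}}'''(x_j^\pm)$ are the one-sided limits of the third derivative at $x_j$.
   Context: $\Omega=[0,1]$. A grid function is a vector $\mathfrak{v}=(\mathfrak{v}_j)_{j=0}^N$; $l^2_{h,0}$ is the space of grid functions with $\mathfrak{v}_0=\mathfrak{v}_N=0$. $H^2_0(\Omega)$ is the space of functions with first and second distributional derivatives in $L^2(\Omega)$ that vanish together with their first derivatives at $0$ and $1$. Cubic spline: for $\mathfrak{u}\in l^2_{h,0}$, $s_{\mathfrak{u}}$ is the unique function in $C^2(\Omega)\cap H^2_0(\Omega)$ that is a polynomial of degree at most $3$ on each interval $[x_j,x_{j+1}]$, $0\le j\le N-1$, and satisfies $s_{\mathfrak{u}}(x_j)=\mathfrak{u}_j$ for $0\le j\le N$ (so also $s_{\mathfrak{u}}'(0)=s_{\mathfrak{u}}'(1)=0$). Finite differences, for $1\le j\le N-1$: $(\delta_x\mathfrak{v})_j=\frac{\mathfrak{v}_{j+1}-\mathfrak{v}_{j-1}}{2h}$ and $(\delta_x^2\mathfrak{v})_j=\frac{\mathfrak{v}_{j+1}-2\mathfrak{v}_j+\mathfrak{v}_{j-1}}{h^2}$.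 Hermitian derivative: for $\mathfrak{u}\in l^2_{h,0}$, $\mathfrak{u}_x$ is the unique element of $l^2_{h,0}$ with $\tfrac16(\mathfrak{u}_x)_{j-1}+\tfrac23(\mathfrak{u}_x)_j+\tfrac16(\mathfrak{u}_x)_{j+1}=(\delta_x\mathfrak{u})_j$ for $1\le j\le N-1$. Discrete biharmonic operator: $$(\delta_x^4\mathfrak{u})_j=\frac{12}{h^2}\big[(\delta_x\mathfrak{u}_x)_j-(\delta_x^2\mathfrak{u})_j\big],\qquad 1\le j\le N-1.$$ *)

theory Defs
  imports "HOL-Analysis.Analysis" "HOL-Computational_Algebra.Polynomial"
begin

text \<open>A grid function \<open>(v\<^sub>0, \<dots>, v\<^sub>N)\<close> is a function on \<^typ>\<open>nat\<close> that is
  set to \<open>0\<close> beyond the index \<open>N\<close>, so that grid functions are equal iff they agree on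
  \<open>0, \<dots>, N\<close>.\<close>

definition l2h0 :: "nat \<Rightarrow> (nat \<Rightarrow> real) set" where
  "l2h0 N = {v. v 0 = 0 \<and> v N = 0 \<and> (\<forall>j>N. v j = 0)}"

definition mesh :: "nat \<Rightarrow> real" where
  "mesh N = 1 / real N"

definition node :: "nat \<Rightarrow> nat \<Rightarrow> real" where
  "node N j = real j * mesh N"

text \<open>All difference operators below are meaningful only for \<open>1 \<le> j \<le> N - 1\<close>.\<close>

definition delta_x :: "nat \<Rightarrow> (nat \<Rightarrow> real) \<Rightarrow> nat \<Rightarrow> real" where
  "delta_x N v j = (v (j + 1) - v (j - 1)) / (2 * mesh N)"

definition delta2_x :: "nat \<Rightarrow> (nat \<Rightarrow> real) \<Rightarrow> nat \<Rightarrow> real" where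
  "delta2_x N v j = (v (j + 1) - 2 * v j + v (j - 1)) / (mesh N)\<^sup>2"

definition hermitian_deriv :: "nat \<Rightarrow> (nat \<Rightarrow> real) \<Rightarrow> nat \<Rightarrow> real" where
  "hermitian_deriv N u = (THE w. w \<in> l2h0 N \<and>
     (\<forall>j\<in>{1..N - 1}. 1/6 * w (j - 1) + 2/3 * w j + 1/6 * w (j + 1) = delta_x N u j))"

definition delta4_x :: "nat \<Rightarrow> (nat \<Rightarrow> real) \<Rightarrow> nat \<Rightarrow> real" where
  "delta4_x N u j =
     12 / (mesh N)\<^sup>2 * (delta_x N (hermitian_deriv N u) j - delta2_x N u j)"

definition test_function :: "(real \<Rightarrow> real) \<Rightarrow> bool" where
  "test_function \<phi> \<longleftrightarrow>
     (\<forall>n x. (deriv ^^ n) \<phi> differentiable (at x)) \<and>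
     (\<exists>a b. 0 < a \<and> b < 1 \<and> (\<forall>x. x \<notin> {a..b} \<longrightarrow> \<phi> x = 0))"

definition square_integrable :: "(real \<Rightarrow> real) \<Rightarrow> bool" where
  "square_integrable f \<longleftrightarrow>
     set_borel_measurable lebesgue {0<..<1} f \<and>
     set_integrable lebesgue {0<..<1} (\<lambda>x. (f x)\<^sup>2)"

definition distributional_deriv :: "nat \<Rightarrow> (real \<Rightarrow> real) \<Rightarrow> (real \<Rightarrow> real) \<Rightarrow> bool" where
  "distributional_deriv k f g \<longleftrightarrow>
     (\<forall>\<phi>. test_function \<phi> \<longrightarrow>
        (LINT x:{0<..<1}|lebesgue. f x * (deriv ^^ k) \<phi> x) =
        (-1) ^ k * (LINT x:{0<..<1}|lebesgue. g x * \<phi> x))"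

text \<open>Elements of \<open>H\<^sup>2\<^sub>0\<close> are represented by their continuous representative, which is
  automatically \<open>C\<^sup>1\<close> on \<open>[0,1]\<close>; the boundary values are therefore the classical ones.\<close>

definition H2_0 :: "(real \<Rightarrow> real) set" where
  "H2_0 = {f. continuous_on {0..1} f \<and>
     (\<exists>g. square_integrable g \<and> distributional_deriv 1 f g) \<and>
     (\<exists>g. square_integrable g \<and> distributional_deriv 2 f g) \<and>
     f 0 = 0 \<and> f 1 = 0 \<and>
     (f has_real_derivative 0) (at 0 within {0..1}) \<and>
     (f has_real_derivative 0) (at 1 within {0..1})}"

definition C2 :: "(real \<Rightarrow> real) set" where
  "C2 = {f. \<exists>f' f''.
     (\<forall>x\<in>{0..1}. (f has_real_derivative f' x) (at x within {0..1})) \<and>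
     (\<forall>x\<in>{0..1}. (f' has_real_derivative f'' x) (at x within {0..1})) \<and>
     continuous_on {0..1} f''}"

text \<open>This characterises the restriction of \<open>s\<close> to \<open>[0,1]\<close>; the values of \<open>s\<close> outside
  \<open>[0,1]\<close> are irrelevant.\<close>

definition is_cubic_spline :: "nat \<Rightarrow> (nat \<Rightarrow> real) \<Rightarrow> (real \<Rightarrow> real) \<Rightarrow> bool" where
  "is_cubic_spline N u s \<longleftrightarrow>
     s \<in> C2 \<inter> H2_0 \<and>
     (\<forall>j<N. \<exists>p :: real poly. degree p \<le> 3 \<and>
        (\<forall>x\<in>{node N j..node N (j + 1)}. s x = poly p x)) \<and>
     (\<forall>j\<le>N. s (node N j) = u j)"

end

theory Submission
  imports Defs
begin

text \<open>Write \<open>u\<^sub>j\<close> and \<open>d\<^sub>j\<close> for the values of the spline and of its first derivative at the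
  nodes. On a single cell the spline is a cubic, hence determined by the Hermite data
  \<open>u\<^sub>j, u\<^sub>j\<^sub>+\<^sub>1, d\<^sub>j, d\<^sub>j\<^sub>+\<^sub>1\<close>, and its second derivatives at the two ends and its
  constant third derivative are explicit linear combinations of these data
  (\<open>cubic_second_deriv_left\<close>, \<open>cubic_second_deriv_right\<close>, \<open>cubic_third_deriv\<close>).

  Equating the two expressions for the second derivative at an interior node, once from the
  cell on the left and once from the cell on the right, gives exactly the tridiagonal
  system \<open>d\<^sub>j\<^sub>-\<^sub>1/6 + 2 d\<^sub>j/3 + d\<^sub>j\<^sub>+\<^sub>1/6 = (u\<^sub>j\<^sub>+\<^sub>1 - u\<^sub>j\<^sub>-\<^sub>1) / (2h)\<close> that
  defines the Hermitian derivative, and the clamped boundary conditions say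
  \<open>d\<^sub>0 = d\<^sub>N = 0\<close>. As that system is strictly diagonally dominant, it has only one
  solution, so the Hermitian derivative of \<open>u\<close> consists of the true slopes of the spline
  (\<open>hermitian_deriv_eq_spline_slope\<close>). Subtracting the third derivatives on the two cells
  that meet at \<open>x\<^sub>j\<close> then yields
  \<open>6 (d\<^sub>j\<^sub>+\<^sub>1 - d\<^sub>j\<^sub>-\<^sub>1) / h\<^sup>2 - 12 (u\<^sub>j\<^sub>+\<^sub>1 - 2 u\<^sub>j + u\<^sub>j\<^sub>-\<^sub>1) / h\<^sup>3\<close>, which
  is \<open>h\<close> times the discrete biharmonic operator.\<close>

section \<open>Hermite data of a cubic\<close>

lemma cubic_coeffs:
  fixes p :: "'a::comm_ring_1 poly"
  assumes "degree p \<le> 3"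
  obtains c0 c1 c2 c3 where "p = [:c0, c1, c2, c3:]"
proof
  show "p = [:coeff p 0, coeff p 1, coeff p 2, coeff p 3:]"
  proof (rule poly_eqI)
    fix n :: nat
    have "n = 0 \<or> n = 1 \<or> n = 2 \<or> n = 3 \<or> n > 3" by linarith
    then show "coeff p n = coeff [:coeff p 0, coeff p 1, coeff p 2, coeff p 3:] n"
      using assms
      by (auto simp: coeff_pCons numeral_eq_Suc coeff_eq_0 split: nat.split)
  qed
qed

lemma cubic_second_deriv_left:
  fixes p :: "real poly"
  assumes "degree p \<le> 3"
  shows "(b - a)\<^sup>2 * poly (pderiv (pderiv p)) a =
    6 * (poly p b - poly p a) - (b - a) * (4 * poly (pderiv p) a + 2 * poly (pderiv p) b)"
proof -
  from assms obtain c0 c1 c2 c3 where "p = [:c0, c1, c2, c3:]" by (rule cubic_coeffs)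
  then show ?thesis by (simp add: pderiv_pCons algebra_simps power2_eq_square)
qed

text \<open>Reflecting the cubic exchanges the two ends, so this is the previous formula with
  \<open>a\<close> and \<open>b\<close> interchanged.\<close>

lemma cubic_second_deriv_right:
  fixes p :: "real poly"
  assumes "degree p \<le> 3"
  shows "(b - a)\<^sup>2 * poly (pderiv (pderiv p)) b =
    - 6 * (poly p b - poly p a) + (b - a) * (2 * poly (pderiv p) a + 4 * poly (pderiv p) b)"
  using cubic_second_deriv_left[OF assms, of a b] by (simp add: power2_commute algebra_simps)

lemma cubic_third_deriv:
  fixes p :: "real poly"
  assumes "degree p \<le> 3"
  shows "(b - a) ^ 3 * poly ((pderiv ^^ 3) p) x =
    - 12 * (poly p b - poly p a) + 6 * (b - a) * (poly (pderiv p) a + poly (pderiv p) b)"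
proof -
  from assms obtain c0 c1 c2 c3 where "p = [:c0, c1, c2, c3:]" by (rule cubic_coeffs)
  then show ?thesis by (simp add: pderiv_pCons algebra_simps eval_nat_numeral)
qed

section \<open>Derivatives of functions that are polynomial on an interval\<close>

text \<open>Derivatives within a nondegenerate interval are unique even at its endpoints, so the
  polynomial of a cell determines the derivative at the nodes too, from either side.\<close>

lemma deriv_within_eq_pderiv:
  fixes f f' :: "real \<Rightarrow> real"
  assumes "\<And>x. x \<in> S \<Longrightarrow> (f has_real_derivative f' x) (at x within S)"
    and "{a..b} \<subseteq> S" "a < b"
    and "\<And>x. x \<in> {a..b} \<Longrightarrow> f x = poly p x"
    and "x \<in> {a..b}"
  shows "f' x = poly (pderiv p) x"
proof -
  have "(f has_real_derivative f' x) (at x within {a..b})"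
    using assms(1,2,5) DERIV_subset by blast
  then have "(poly p has_real_derivative f' x) (at x within {a..b})"
    by (rule has_field_derivative_transform_within[OF _ zero_less_one]) (use assms(4,5) in auto)
  moreover have "(poly p has_real_derivative poly (pderiv p) x) (at x within {a..b})"
    by (rule has_field_derivative_at_within[OF poly_DERIV])
  moreover have "at x within {a..b} \<noteq> bot"
    using assms(3,5) by (simp add: trivial_limit_within)
  ultimately show ?thesis
    using has_field_derivative_unique by blast
qed

lemma higher_deriv_eq_pderiv:
  fixes f :: "real \<Rightarrow> real"
  assumes "open S" and "\<And>x. x \<in> S \<Longrightarrow> f x = poly p x" and "x \<in> S"
  shows "(deriv ^^ n) f x = poly ((pderiv ^^ n) p) x"
  using assms(3)
proof (induction n arbitrary: x)
  case 0
  then show ?case using assms(2) by simp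
next
  case (Suc n)
  have "((deriv ^^ n) f has_real_derivative poly (pderiv ((pderiv ^^ n) p)) x) (at x)"
    by (rule has_field_derivative_transform_within_open[OF poly_DERIV \<open>open S\<close> \<open>x \<in> S\<close>])
      (simp add: Suc.IH)
  then show ?case by (simp add: DERIV_imp_deriv)
qed

lemma higher_deriv_tendsto_poly_at_right:
  fixes f :: "real \<Rightarrow> real"
  assumes "a < b" and "\<And>x. x \<in> {a..b} \<Longrightarrow> f x = poly p x"
  shows "((deriv ^^ n) f \<longlongrightarrow> poly ((pderiv ^^ n) p) a) (at_right a)"
proof (rule Lim_transform_eventually)
  show "(poly ((pderiv ^^ n) p) \<longlongrightarrow> poly ((pderiv ^^ n) p) a) (at_right a)"
    by (intro tendsto_intros)
  have "\<And>x. x \<in> {a<..<b} \<Longrightarrow> f x = poly p x" using assms(2) by simp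
  from higher_deriv_eq_pderiv[OF open_greaterThanLessThan this]
  show "\<forall>\<^sub>F x in at_right a. poly ((pderiv ^^ n) p) x = (deriv ^^ n) f x"
    using assms(1) by (auto simp: eventually_at_right[of a b])
qed

lemma higher_deriv_tendsto_poly_at_left:
  fixes f :: "real \<Rightarrow> real"
  assumes "a < b" and "\<And>x. x \<in> {a..b} \<Longrightarrow> f x = poly p x"
  shows "((deriv ^^ n) f \<longlongrightarrow> poly ((pderiv ^^ n) p) b) (at_left b)"
proof (rule Lim_transform_eventually)
  show "(poly ((pderiv ^^ n) p) \<longlongrightarrow> poly ((pderiv ^^ n) p) b) (at_left b)"
    by (intro tendsto_intros)
  have "\<And>x. x \<in> {a<..<b} \<Longrightarrow> f x = poly p x" using assms(2) by simp
  from higher_deriv_eq_pderiv[OF open_greaterThanLessThan this]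
  show "\<forall>\<^sub>F x in at_left b. poly ((pderiv ^^ n) p) x = (deriv ^^ n) f x"
    using assms(1) by (auto simp: eventually_at_left[of a b])
qed

section \<open>The Hermitian derivative\<close>

text \<open>At an index where \<open>\<bar>z\<bar>\<close> is largest, the two off-diagonal terms together amount to at
  most half of the diagonal one, so they cannot cancel it unless \<open>z\<close> vanishes.\<close>

lemma hermitian_system_kernel:
  assumes z: "z \<in> l2h0 N"
    and eq: "\<And>j. j \<in> {1..N - 1} \<Longrightarrow> 1/6 * z (j - 1) + 2/3 * z j + 1/6 * z (j + 1) = 0"
  shows "z = (\<lambda>_. 0)"
proof -
  define M where "M = Max ((\<lambda>i. \<bar>z i\<bar>) ` {..N})"
  have le_M: "\<bar>z i\<bar> \<le> M" for i
  proof (cases "i \<le> N")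
    case True
    then show ?thesis unfolding M_def by (intro Max_ge) auto
  next
    case False
    then have "z i = z 0" using z by (simp add: l2h0_def)
    then show ?thesis unfolding M_def by (intro Max_ge) auto
  qed
  have "M \<in> (\<lambda>i. \<bar>z i\<bar>) ` {..N}" unfolding M_def by (intro Max_in) auto
  then obtain k where k: "k \<le> N" "M = \<bar>z k\<bar>" by auto
  have "M = 0"
  proof (cases "k \<in> {1..N - 1}")
    case True
    then show ?thesis
      using eq[OF True] le_M[of "k - 1"] le_M[of "k + 1"] k(2) by linarith
  next
    case False
    then have "k = 0 \<or> k = N" using k(1) by auto
    then show ?thesis using z k(2) by (auto simp: l2h0_def)
  qed
  then show ?thesis using le_M by (intro ext) (metis abs_le_zero_iff)
qed

lemma hermitian_deriv_unique:
  assumes w: "w \<in> l2h0 N"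
    and eq: "\<And>j. j \<in> {1..N - 1} \<Longrightarrow>
      1/6 * w (j - 1) + 2/3 * w j + 1/6 * w (j + 1) = delta_x N u j"
  shows "hermitian_deriv N u = w"
  unfolding hermitian_deriv_def
proof (rule the_equality)
  show "w \<in> l2h0 N \<and> (\<forall>j\<in>{1..N - 1}.
      1/6 * w (j - 1) + 2/3 * w j + 1/6 * w (j + 1) = delta_x N u j)"
    using assms by blast
next
  fix v
  assume v: "v \<in> l2h0 N \<and> (\<forall>j\<in>{1..N - 1}.
      1/6 * v (j - 1) + 2/3 * v j + 1/6 * v (j + 1) = delta_x N u j)"
  have "(\<lambda>i. v i - w i) = (\<lambda>_. 0)"
  proof (rule hermitian_system_kernel)
    show "(\<lambda>i. v i - w i) \<in> l2h0 N" using v w by (simp add: l2h0_def)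
    show "1/6 * (v (j - 1) - w (j - 1)) + 2/3 * (v j - w j) + 1/6 * (v (j + 1) - w (j + 1)) = 0"
      if "j \<in> {1..N - 1}" for j
    proof -
      have "1/6 * (v (j - 1) - w (j - 1)) + 2/3 * (v j - w j) + 1/6 * (v (j + 1) - w (j + 1)) =
          (1/6 * v (j - 1) + 2/3 * v j + 1/6 * v (j + 1)) -
          (1/6 * w (j - 1) + 2/3 * w j + 1/6 * w (j + 1))"
        by (simp only: right_diff_distrib add_diff_add)
      also have "\<dots> = 0" using v eq[OF that] that by simp
      finally show ?thesis .
    qed
  qed
  then show "v = w" by (simp add: fun_eq_iff)
qed

section \<open>Cubic splines\<close>

text \<open>The slope of \<open>s\<close> relative to \<open>[0,1]\<close>; at the two endpoints it is one-sided, where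
  \<^const>\<open>deriv\<close> would depend on values of \<open>s\<close> outside the interval.\<close>

definition slope01 :: "(real \<Rightarrow> real) \<Rightarrow> real \<Rightarrow> real" where
  "slope01 s x = (THE d. (s has_real_derivative d) (at x within {0..1}))"

lemma slope01_eq:
  assumes "(s has_real_derivative d) (at x within {0..1})" "x \<in> {0..1}"
  shows "slope01 s x = d"
proof -
  have "at x within {0..1::real} \<noteq> bot"
    using assms(2) by (simp add: trivial_limit_within)
  then show ?thesis
    unfolding slope01_def using assms(1) has_field_derivative_unique by blast
qed

lemma node_step: "node N (j + 1) - node N j = mesh N"
  by (simp add: node_def algebra_simps)

lemma node_less:
  assumes "N > 0"
  shows "node N j < node N (j + 1)"
  using assms by (simp add: node_def mesh_def divide_strict_right_mono)

lemma node_in_unit_interval: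
  assumes "N > 0" "j \<le> N"
  shows "node N j \<in> {0..1}"
  using assms by (simp add: node_def mesh_def)

lemma cell_subset_unit_interval:
  assumes "j < N"
  shows "{node N j..node N (j + 1)} \<subseteq> {0..1}"
  using assms node_in_unit_interval[of N j] node_in_unit_interval[of N "j + 1"] by auto

text \<open>The Hermite formulas, applied on every cell. The witness for \<open>s2\<close> is the second
  derivative of \<open>s\<close>; that it is one function for all cells is the smoothness that ties
  neighbouring cubics together.\<close>

lemma spline_cell_polys:
  assumes "N > 0" and spline: "is_cubic_spline N u s"
  obtains P s2 where
    "\<And>j x. j < N \<Longrightarrow> x \<in> {node N j..node N (j + 1)} \<Longrightarrow> s x = poly (P j) x"
    "\<And>j. j < N \<Longrightarrow> (mesh N)\<^sup>2 * s2 (node N j) =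
      6 * (u (j + 1) - u j)
      - mesh N * (4 * slope01 s (node N j) + 2 * slope01 s (node N (j + 1)))"
    "\<And>j. j < N \<Longrightarrow> (mesh N)\<^sup>2 * s2 (node N (j + 1)) =
      - 6 * (u (j + 1) - u j)
      + mesh N * (2 * slope01 s (node N j) + 4 * slope01 s (node N (j + 1)))"
    "\<And>j x. j < N \<Longrightarrow> mesh N ^ 3 * poly ((pderiv ^^ 3) (P j)) x =
      - 12 * (u (j + 1) - u j)
      + 6 * mesh N * (slope01 s (node N j) + slope01 s (node N (j + 1)))"
proof -
  have "\<forall>j<N. \<exists>p :: real poly. degree p \<le> 3 \<and>
      (\<forall>x\<in>{node N j..node N (j + 1)}. s x = poly p x)"
    using spline unfolding is_cubic_spline_def by blast
  then obtain P :: "nat \<Rightarrow> real poly" where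
    deg: "\<And>j. j < N \<Longrightarrow> degree (P j) \<le> 3" and
    val: "\<And>j x. j < N \<Longrightarrow> x \<in> {node N j..node N (j + 1)} \<Longrightarrow> s x = poly (P j) x"
    by metis
  from spline have "s \<in> C2" unfolding is_cubic_spline_def by blast
  then obtain s1 s2 where
    s1: "\<And>x. x \<in> {0..1} \<Longrightarrow> (s has_real_derivative s1 x) (at x within {0..1})" and
    s2: "\<And>x. x \<in> {0..1} \<Longrightarrow> (s1 has_real_derivative s2 x) (at x within {0..1})"
    unfolding C2_def by blast
  have first: "s1 x = poly (pderiv (P j)) x"
    if "j < N" "x \<in> {node N j..node N (j + 1)}" for j x
    using deriv_within_eq_pderiv[OF s1 cell_subset_unit_interval[OF that(1)]
        node_less[OF assms(1)] val[OF that(1)] that(2)] .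
  have second: "s2 x = poly (pderiv (pderiv (P j))) x"
    if "j < N" "x \<in> {node N j..node N (j + 1)}" for j x
    using deriv_within_eq_pderiv[OF s2 cell_subset_unit_interval[OF that(1)]
        node_less[OF assms(1)] first[OF that(1)] that(2)] .
  have slope: "slope01 s x = poly (pderiv (P j)) x"
    if "j < N" "x \<in> {node N j..node N (j + 1)}" for j x
    using slope01_eq[OF s1] cell_subset_unit_interval[OF that(1)] first[OF that] that(2) by auto
  have u: "s (node N k) = u k" if "k \<le> N" for k
    using spline that unfolding is_cubic_spline_def by blast
  have ends: "node N k \<in> {node N k..node N (k + 1)}"
    "node N (k + 1) \<in> {node N k..node N (k + 1)}" for k
    using node_less[OF assms(1), of k] by auto
  show thesis
  proof (rule that[of P s2])
    fix j assume j: "j < N"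
    then have "u j = poly (P j) (node N j)" "u (j + 1) = poly (P j) (node N (j + 1))"
      using u[of j] u[of "j + 1"] val[OF j ends(1)] val[OF j ends(2)] by linarith+
    note data = this slope[OF j ends(1)] slope[OF j ends(2)]
      second[OF j ends(1)] second[OF j ends(2)] node_step[of N j, symmetric]
    show "(mesh N)\<^sup>2 * s2 (node N j) = 6 * (u (j + 1) - u j)
        - mesh N * (4 * slope01 s (node N j) + 2 * slope01 s (node N (j + 1)))"
      unfolding data by (rule cubic_second_deriv_left[OF deg[OF j]])
    show "(mesh N)\<^sup>2 * s2 (node N (j + 1)) = - 6 * (u (j + 1) - u j)
        + mesh N * (2 * slope01 s (node N j) + 4 * slope01 s (node N (j + 1)))"
      unfolding data by (rule cubic_second_deriv_right[OF deg[OF j]])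
    show "mesh N ^ 3 * poly ((pderiv ^^ 3) (P j)) x = - 12 * (u (j + 1) - u j)
        + 6 * mesh N * (slope01 s (node N j) + slope01 s (node N (j + 1)))" for x
      unfolding data by (rule cubic_third_deriv[OF deg[OF j]])
  qed (rule val)
qed

text \<open>The spline slopes solve the tridiagonal system because the second derivative is
  continuous at the interior nodes.\<close>

lemma hermitian_deriv_eq_spline_slope:
  assumes "N > 0" and spline: "is_cubic_spline N u s"
  shows "hermitian_deriv N u = (\<lambda>j. if j \<le> N then slope01 s (node N j) else 0)"
    (is "_ = ?w")
proof (rule hermitian_deriv_unique)
  have "(s has_real_derivative 0) (at 0 within {0..1})"
    and "(s has_real_derivative 0) (at 1 within {0..1})"
    using spline unfolding is_cubic_spline_def H2_0_def by blast+
  then have "slope01 s 0 = 0" "slope01 s 1 = 0" by (auto intro: slope01_eq)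
  then show "?w \<in> l2h0 N" using assms(1) by (simp add: l2h0_def node_def mesh_def)
next
  fix j assume j: "j \<in> {1..N - 1}"
  \<comment> \<open>The node \<open>x\<^sub>j\<close> is shared by the cells with indices \<open>i = j - 1\<close> and \<open>j\<close>.\<close>
  define i where "i = j - 1"
  have ij: "j = i + 1" "i < N" "i + 1 < N" using j by (auto simp: i_def)
  let ?d = "\<lambda>k. slope01 s (node N k)"
  let ?h = "mesh N"
  have h: "?h > 0" using assms(1) by (simp add: mesh_def)
  obtain s2 where
    right: "\<And>k. k < N \<Longrightarrow> ?h\<^sup>2 * s2 (node N k) =
      6 * (u (k + 1) - u k) - ?h * (4 * ?d k + 2 * ?d (k + 1))" and
    left: "\<And>k. k < N \<Longrightarrow> ?h\<^sup>2 * s2 (node N (k + 1)) =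
      - 6 * (u (k + 1) - u k) + ?h * (2 * ?d k + 4 * ?d (k + 1))"
    using spline_cell_polys[OF assms] by metis
  have "6 * (u (j + 1) - u j) - ?h * (4 * ?d j + 2 * ?d (j + 1)) =
      - 6 * (u j - u i) + ?h * (2 * ?d i + 4 * ?d j)"
    using right[of j] left[of i] ij by simp
  then have "?h * (1/6 * ?d i + 2/3 * ?d j + 1/6 * ?d (j + 1)) = (u (j + 1) - u i) / 2"
    by (simp add: algebra_simps)
  then have "1/6 * ?d i + 2/3 * ?d j + 1/6 * ?d (j + 1) = (u (j + 1) - u i) / (2 * ?h)"
    using h by (simp add: eq_divide_eq mult_ac)
  then show "1/6 * ?w (j - 1) + 2/3 * ?w j + 1/6 * ?w (j + 1) = delta_x N u j"
    using ij by (simp add: delta_x_def)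
qed

theorem proposition4p4:
  fixes N :: nat and u :: "nat \<Rightarrow> real" and s :: "real \<Rightarrow> real" and j :: nat
  assumes "N \<ge> 2"
    and "u \<in> l2h0 N"
    and "is_cubic_spline N u s"
    and "1 \<le> j" and "j \<le> N - 1"
  shows "\<exists>s3_right s3_left.
      ((deriv ^^ 3) s \<longlongrightarrow> s3_right) (at_right (node N j)) \<and>
      ((deriv ^^ 3) s \<longlongrightarrow> s3_left) (at_left (node N j)) \<and>
      s3_right - s3_left = mesh N * delta4_x N u j"
proof -
  have N: "N > 0" using assms(1) by simp
  define i where "i = j - 1"
  have ij: "j = i + 1" "i < N" "j < N" using assms(1,4,5) by (auto simp: i_def)
  let ?d = "hermitian_deriv N u"
  let ?h = "mesh N"
  have h: "?h > 0" using N by (simp add: mesh_def)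
  obtain P where
    val: "\<And>k x. k < N \<Longrightarrow> x \<in> {node N k..node N (k + 1)} \<Longrightarrow> s x = poly (P k) x" and
    third: "\<And>k x. k < N \<Longrightarrow> ?h ^ 3 * poly ((pderiv ^^ 3) (P k)) x =
      - 12 * (u (k + 1) - u k)
      + 6 * ?h * (slope01 s (node N k) + slope01 s (node N (k + 1)))"
    using spline_cell_polys[OF N assms(3)] by metis
  have d: "slope01 s (node N k) = ?d k" if "k \<le> N" for k
    using that by (simp add: hermitian_deriv_eq_spline_slope[OF N assms(3)])
  let ?R = "poly ((pderiv ^^ 3) (P j)) (node N j)"
  let ?L = "poly ((pderiv ^^ 3) (P i)) (node N j)"
  have "((deriv ^^ 3) s \<longlongrightarrow> ?R) (at_right (node N j))"
    by (rule higher_deriv_tendsto_poly_at_right[OF node_less[OF N] val[OF ij(3)]])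
  moreover have "((deriv ^^ 3) s \<longlongrightarrow> ?L) (at_left (node N j))"
    unfolding ij(1)
    by (rule higher_deriv_tendsto_poly_at_left[OF node_less[OF N] val[OF ij(2)]])
  moreover have "?R - ?L = ?h * delta4_x N u j"
  proof -
    have "?h ^ 3 * ?R = - 12 * (u (j + 1) - u j) + 6 * ?h * (?d j + ?d (j + 1))"
      using third[OF ij(3)] d[of j] d[of "j + 1"] ij(3) by simp
    moreover have "?h ^ 3 * ?L = - 12 * (u j - u i) + 6 * ?h * (?d i + ?d j)"
      using third[OF ij(2)] d[of i] d[of j] ij by simp
    ultimately have "?h ^ 3 * (?R - ?L) =
        6 * ?h * (?d (j + 1) - ?d i) - 12 * (u (j + 1) - 2 * u j + u i)"
      by (simp add: algebra_simps)
    also have "\<dots> = ?h ^ 3 * (?h * delta4_x N u j)"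
    proof -
      have j: "j - 1 = i" using ij(1) by simp
      show ?thesis
        using h unfolding delta4_x_def delta_x_def delta2_x_def j
        by (simp add: field_simps power2_eq_square power3_eq_cube)
    qed
    finally show ?thesis using h by simp
  qed
  ultimately show ?thesis by blast
qed

end
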